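(* Let $H$ be a complex Hilbert space. Assume that either $H$ is finite dimensional with $\dim H\ge2$, or $H$ is separable and infinite dimensional. Then there exist two compact linear operators $\mathbf M,\mathbf J:H\to H$ such that $N(\mathbf J)\cap N(\mathbf I+\mathbf M)=\{0\}$ and, for every $\xi\in\mathbb C$, the operator $\mathbf I+\mathbf M+\xi\mathbf J$ is singular.
   Context: $N(T)$ denotes the null space of a linear operator $T$, $\mathbf I$ is the identity on $H$, and "singular" means not (boundedly) invertible. *)

theory Defs
  imports "HOL-Analysis.Analysis"
begin

(* Complex inner product spaces. The distribution only provides real ones (class real_inner).
   The inner product is conjugate-linear in the first and linear in the second argument.
   The real normed structure is the one underlying the complex one: scaleR_scaleC and
   norm_eq_sqrt_cinner determine scaleR and norm, and hence the metric and the topology;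
   the remaining axioms of real_normed_vector then add no restriction. *)
class complex_inner = real_normed_vector +
  fixes scaleC :: "complex \<Rightarrow> 'a \<Rightarrow> 'a" (infixr "*\<^sub>C" 75)
    and cinner :: "'a \<Rightarrow> 'a \<Rightarrow> complex"
  assumes scaleC_add_right: "a *\<^sub>C (x + y) = a *\<^sub>C x + a *\<^sub>C y"
    and scaleC_add_left: "(a + b) *\<^sub>C x = a *\<^sub>C x + b *\<^sub>C x"
    and scaleC_scaleC: "a *\<^sub>C (b *\<^sub>C x) = (a * b) *\<^sub>C x"
    and scaleC_one: "1 *\<^sub>C x = x"
    and scaleR_scaleC: "r *\<^sub>R x = complex_of_real r *\<^sub>C x"
    and cinner_commute: "cinner x y = cnj (cinner y x)"
    and cinner_add_right: "cinner x (y + z) = cinner x y + cinner x z"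
    and cinner_scaleC_right: "cinner x (a *\<^sub>C y) = a * cinner x y"
    and cinner_ge_zero: "0 \<le> Re (cinner x x)"
    and cinner_eq_zero_iff: "cinner x x = 0 \<longleftrightarrow> x = 0"
    and norm_eq_sqrt_cinner: "norm x = sqrt (Re (cinner x x))"

class complex_hilbert = complex_inner + complete_space

global_interpretation complex_vector:
  vector_space "scaleC :: complex \<Rightarrow> 'a \<Rightarrow> 'a::complex_inner"
  defines cspan = complex_vector.span
    and cdim = complex_vector.dim
  by unfold_locales
    (simp_all add: scaleC_add_right scaleC_add_left scaleC_scaleC scaleC_one)

abbreviation clinear :: "('a::complex_inner \<Rightarrow> 'b::complex_inner) \<Rightarrow> bool" where
  "clinear \<equiv> Vector_Spaces.linear scaleC scaleC"

(* The value of cdim is 0 in infinite dimensions, so finiteness is expressed separately. *)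
definition finite_cdim :: "'a::complex_inner itself \<Rightarrow> bool" where
  "finite_cdim _ \<longleftrightarrow> (\<exists>B :: 'a set. finite B \<and> cspan B = UNIV)"

definition bounded_clinear :: "('a::complex_inner \<Rightarrow> 'b::complex_inner) \<Rightarrow> bool" where
  "bounded_clinear T \<longleftrightarrow> clinear T \<and> (\<exists>K. \<forall>x. norm (T x) \<le> K * norm x)"

definition compact_clinear :: "('a::complex_inner \<Rightarrow> 'b::complex_inner) \<Rightarrow> bool" where
  "compact_clinear T \<longleftrightarrow> clinear T \<and> (\<forall>S. bounded S \<longrightarrow> compact (closure (T ` S)))"

definition null_space :: "('a::complex_inner \<Rightarrow> 'b::complex_inner) \<Rightarrow> 'a set" where
  "null_space T = {x. T x = 0}"

definition boundedly_invertible :: "('a::complex_inner \<Rightarrow> 'b::complex_inner) \<Rightarrow> bool" where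
  "boundedly_invertible T \<longleftrightarrow> (\<exists>S. bounded_clinear S \<and> S \<circ> T = id \<and> T \<circ> S = id)"

abbreviation singular :: "('a::complex_inner \<Rightarrow> 'b::complex_inner) \<Rightarrow> bool" where
  "singular T \<equiv> \<not> boundedly_invertible T"

end

theory Submission
  imports Defs
begin

text \<open>
  Two independent directions suffice. Let \<open>e\<close> be a unit vector, \<open>u \<noteq> 0\<close> orthogonal
  to \<open>e\<close>, \<open>M x = - \<langle>e, x\<rangle> e\<close> and \<open>J x = \<langle>e, x\<rangle> u\<close>; both have rank one. Every
  \<open>I + M + \<xi> J\<close> has range in the orthogonal complement of \<open>e\<close>, hence is singular, while
  the kernel of \<open>I + M\<close> is spanned by \<open>e\<close>, on which \<open>J\<close> does not vanish.
\<close>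

lemma cinner_zero_right [simp]: "cinner x (0 :: 'a::complex_inner) = 0"
  using cinner_add_right[of x 0 0] by simp

lemma cinner_zero_left [simp]: "cinner (0 :: 'a::complex_inner) x = 0"
  using cinner_commute[of 0 x] by simp

lemma cinner_minus_right: "cinner x (- y :: 'a::complex_inner) = - cinner x y"
  using cinner_add_right[of x y "- y"] by (simp add: eq_neg_iff_add_eq_0 add.commute)

lemma cinner_diff_right: "cinner x (y - z :: 'a::complex_inner) = cinner x y - cinner x z"
  using cinner_add_right[of x y "- z"] by (simp add: cinner_minus_right)

lemma cinner_diff_left: "cinner (x - y :: 'a::complex_inner) z = cinner x z - cinner y z"
  by (metis cinner_commute cinner_diff_right complex_cnj_diff)

lemma cinner_scaleC_left: "cinner (a *\<^sub>C x) (y :: 'a::complex_inner) = cnj a * cinner x y"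
  by (metis cinner_commute cinner_scaleC_right complex_cnj_mult)

text \<open>Conjugate symmetry makes \<open>cinner x x\<close> real, so the real part that defines
  the norm is all of it.\<close>

lemma cinner_same: "cinner x (x :: 'a::complex_inner) = complex_of_real ((norm x)\<^sup>2)"
proof (rule complex_eqI)
  show "Re (cinner x x) = Re (complex_of_real ((norm x)\<^sup>2))"
    by (simp add: norm_eq_sqrt_cinner cinner_ge_zero)
  have "Im (cinner x x) = - Im (cinner x x)"
    by (subst cinner_commute) simp
  then show "Im (cinner x x) = Im (complex_of_real ((norm x)\<^sup>2))"
    by simp
qed

lemma norm_scaleC: "norm (a *\<^sub>C (x :: 'a::complex_inner)) = cmod a * norm x"
proof -
  have "cinner (a *\<^sub>C x) (a *\<^sub>C x) = (a * cnj a) * cinner x x"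
    by (simp add: cinner_scaleC_left cinner_scaleC_right)
  then have "complex_of_real ((norm (a *\<^sub>C x))\<^sup>2) = complex_of_real ((cmod a * norm x)\<^sup>2)"
    unfolding cinner_same complex_norm_square[symmetric] by (simp add: power_mult_distrib)
  then have "(norm (a *\<^sub>C x))\<^sup>2 = (cmod a * norm x)\<^sup>2"
    unfolding of_real_eq_iff .
  then show ?thesis
    by simp
qed

lemma cinner_Cauchy_Schwarz: "cmod (cinner e x) \<le> norm e * norm (x :: 'a::complex_inner)"
proof (cases "e = 0")
  case False
  define n where "n = (norm e)\<^sup>2"
  define a where "a = cinner e x"
  \<comment> \<open>\<open>y\<close> is \<open>n\<close> times the component of \<open>x\<close>
    orthogonal to \<open>e\<close>; scaling by \<open>n\<close> avoids a division. The inequality is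
    \<open>cinner y y\<close> \<ge> 0, expanded and divided by \<open>n\<close>.\<close>
  define y where "y = complex_of_real n *\<^sub>C x - a *\<^sub>C e"
  have "n > 0"
    using False by (simp add: n_def)
  have "cinner x e = cnj a"
    unfolding a_def by (rule cinner_commute)
  moreover have "cinner e e = complex_of_real n"
    unfolding n_def by (rule cinner_same)
  moreover have "cinner x x = complex_of_real ((norm x)\<^sup>2)"
    by (rule cinner_same)
  ultimately have "cinner y y =
      complex_of_real n * (complex_of_real n * complex_of_real ((norm x)\<^sup>2) - a * cnj a)"
    by (simp add: y_def cinner_diff_left cinner_diff_right cinner_scaleC_left
        cinner_scaleC_right a_def[symmetric] algebra_simps del: of_real_power)
  also have "\<dots> = complex_of_real (n * (n * (norm x)\<^sup>2 - (cmod a)\<^sup>2))"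
    unfolding complex_norm_square[symmetric] by simp
  finally have "cinner y y = complex_of_real (n * (n * (norm x)\<^sup>2 - (cmod a)\<^sup>2))" .
  then have "0 \<le> n * (n * (norm x)\<^sup>2 - (cmod a)\<^sup>2)"
    using cinner_ge_zero[of y] by (simp del: of_real_mult of_real_diff of_real_power)
  then have "(cmod a)\<^sup>2 \<le> (norm e * norm x)\<^sup>2"
    using \<open>n > 0\<close> by (simp add: zero_le_mult_iff n_def power_mult_distrib)
  then show ?thesis
    unfolding a_def by (rule power2_le_imp_le) simp
qed simp

lemma clinear_rank_one: "clinear (\<lambda>x::'a::complex_inner. cinner e x *\<^sub>C (v::'b::complex_inner))"
  by unfold_locales
    (simp_all add: cinner_add_right cinner_scaleC_right scaleC_add_right scaleC_add_left
      scaleC_scaleC scaleC_one)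

text \<open>The operator factors through the scalars: a bounded set is sent into the image of a
  closed disc under \<open>c \<mapsto> c *\<^sub>C v\<close>, and closed discs in the complex plane
  are compact.\<close>

lemma compact_clinear_rank_one:
  "compact_clinear (\<lambda>x::'a::complex_inner. cinner e x *\<^sub>C (v::'b::complex_inner))"
  unfolding compact_clinear_def
proof (intro conjI allI impI clinear_rank_one)
  fix S :: "'a set"
  assume "bounded S"
  then obtain B where B: "\<And>x. x \<in> S \<Longrightarrow> norm x \<le> B"
    by (auto simp: bounded_iff)
  have "cmod (cinner e x) \<le> norm e * B" if "x \<in> S" for x
    using cinner_Cauchy_Schwarz[of e x] mult_left_mono[OF B[OF that], of "norm e"] by simp
  then have sub: "(\<lambda>x. cinner e x *\<^sub>C v) ` S \<subseteq> (\<lambda>c. c *\<^sub>C v) ` cball 0 (norm e * B)"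
    by auto
  \<comment> \<open>Linearity over the reals is enough here, as only continuity is wanted.\<close>
  have "bounded_linear (\<lambda>c. c *\<^sub>C v)"
    by (rule bounded_linear_intro[where K = "norm v"])
      (simp_all add: scaleC_add_left scaleR_scaleC scaleC_scaleC norm_scaleC scaleR_conv_of_real)
  then have K: "compact ((\<lambda>c. c *\<^sub>C v) ` cball 0 (norm e * B))"
    by (intro compact_continuous_image linear_continuous_on) auto
  then have "closure ((\<lambda>x. cinner e x *\<^sub>C v) ` S) \<subseteq> (\<lambda>c. c *\<^sub>C v) ` cball 0 (norm e * B)"
    by (intro closure_minimal sub compact_imp_closed)
  then show "compact (closure ((\<lambda>x. cinner e x *\<^sub>C v) ` S))"
    by (metis K closed_closure compact_Int_closed Int_absorb1)
qed

text \<open>An inverse would put \<open>e\<close> itself in the range of \<open>T\<close>, making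
  \<open>e\<close> orthogonal to itself.\<close>

lemma singular_if_range_orthogonal:
  assumes "\<And>x. cinner e (T x) = 0" and "e \<noteq> 0"
  shows "singular T"
proof
  assume "boundedly_invertible T"
  then obtain S where "T (S e) = e"
    by (auto simp: boundedly_invertible_def fun_eq_iff)
  with assms(1)[of "S e"] \<open>e \<noteq> 0\<close> show False
    by (simp add: cinner_eq_zero_iff)
qed

text \<open>Either alternative prevents one vector from spanning the space; one Gram-Schmidt step
  then gives the pair.\<close>

lemma exists_orthogonal_pair:
  assumes "\<not> finite_cdim TYPE('a::complex_inner) \<or> cdim (UNIV :: 'a set) \<ge> 2"
  obtains e u :: "'a::complex_inner" where "cinner e e = 1" "u \<noteq> 0" "cinner e u = 0"
proof -
  have no_span: "cspan {b} \<noteq> UNIV" for b :: 'a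
  proof
    assume b: "cspan {b} = UNIV"
    then have "cdim (UNIV :: 'a set) \<le> 1"
      using complex_vector.dim_le_card[of UNIV "{b}"] by simp
    with b assms show False
      by (auto simp: finite_cdim_def dest!: spec[of _ "{b}"])
  qed
  obtain b :: 'a where "b \<notin> cspan {0}"
    using no_span[of 0] by blast
  then have "b \<noteq> 0"
    using complex_vector.span_zero by blast
  define e where "e = complex_of_real (1 / norm b) *\<^sub>C b"
  have e: "cinner e e = 1"
    using \<open>b \<noteq> 0\<close> by (simp add: e_def cinner_same norm_scaleC norm_divide)
  obtain v where v: "v \<notin> cspan {e}"
    using no_span by blast
  \<comment> \<open>Subtracting the projection onto \<open>e\<close> leaves a nonzero vector, since
    otherwise \<open>v\<close> would be a multiple of \<open>e\<close>.\<close>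
  define u where "u = v - cinner e v *\<^sub>C e"
  have "u \<noteq> 0"
    using v by (auto simp: u_def complex_vector.span_singleton)
  moreover have "cinner e u = 0"
    by (simp add: u_def cinner_diff_right cinner_scaleC_right e)
  ultimately show thesis
    using e that by blast
qed

theorem propositionA1:
  assumes "(finite_cdim TYPE('a::complex_hilbert) \<and> cdim (UNIV :: 'a set) \<ge> 2) \<or>
    (separable_space (euclidean :: 'a topology) \<and> \<not> finite_cdim TYPE('a))"
  shows "\<exists>M J :: 'a \<Rightarrow> 'a. compact_clinear M \<and> compact_clinear J \<and>
    null_space J \<inter> null_space (\<lambda>x. x + M x) = {0} \<and>
    (\<forall>\<xi>::complex. singular (\<lambda>x. x + M x + \<xi> *\<^sub>C J x))"
proof -
  obtain e u :: 'a where e: "cinner e e = 1" and u: "u \<noteq> 0" "cinner e u = 0"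
    by (rule exists_orthogonal_pair[where 'a = 'a]) (use assms in auto)
  \<comment> \<open>With the sign inside the vector, \<open>M\<close> is literally of the rank-one
    form treated above.\<close>
  define M where "M = (\<lambda>x. cinner e x *\<^sub>C (- e))"
  define J where "J = (\<lambda>x. cinner e x *\<^sub>C u)"
  have "compact_clinear M" "compact_clinear J"
    unfolding M_def J_def by (rule compact_clinear_rank_one)+
  \<comment> \<open>As \<open>u\<close> is nonzero, \<open>J x = 0\<close> forces
    \<open>cinner e x = 0\<close>; then \<open>M x = 0\<close>, and \<open>x + M x = 0\<close>
    reduces to \<open>x = 0\<close>.\<close>
  moreover have "null_space J \<inter> null_space (\<lambda>x. x + M x) = {0}"
    using u(1) by (auto simp: null_space_def M_def J_def)
  moreover have "singular (\<lambda>x. x + M x + \<xi> *\<^sub>C J x)" for \<xi>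
  proof (rule singular_if_range_orthogonal)
    \<comment> \<open>\<open>M\<close> cancels the \<open>e\<close>-component of \<open>x\<close>
      because \<open>e\<close> is a unit vector, and the term in \<xi> is a multiple of
      \<open>u\<close>, orthogonal to \<open>e\<close>.\<close>
    show "cinner e (x + M x + \<xi> *\<^sub>C J x) = 0" for x
      by (simp add: M_def J_def cinner_add_right cinner_diff_right cinner_minus_right
          cinner_scaleC_right e u(2))
    show "e \<noteq> 0"
      using e by auto
  qed
  ultimately show ?thesis
    by blast
qed

end
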